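(* Let $X=\overline{\mathcal O(x)}$ be a transitive subshift, where $x$ is not eventually periodic in both directions (that is, $x$ is not both eventually periodic to the right and eventually periodic to the left). If $g\in\mathbb N$ and $$\liminf_{n\to\infty}(c_X(n)-gn)=-\infty,$$ then $X$ has at most $g-1$ generic measures.
   Context: A subshift is a closed, $\sigma$-invariant subset $X\subset\mathcal A^{\mathbb Z}$, where $\mathcal A$ is a finite alphabet, $\mathcal A^{\mathbb Z}$ carries the product topology, and $\sigma(x)_k=x_{k+1}$ is the left shift. A word of length $n$ in $X$ is a block $x_k x_{k+1}\cdots x_{k+n-1}$ occurring in some $x\in X$; $c_X(n)$ is the number of words of length $n$ in $X$. The orbit of $x$ is $\mathcal O(x)=\{\sigma^n(x):n\in\mathbb Z\}$. A point $x$ is eventually periodic to the right if there exist integers $p>0$, $N>0$ with $x_k=x_{k+p}$ for all $k>N$; it is eventually periodic to the left if there exist integers $p>0$, $N>0$ with $x_k=x_{k-p}$ for all $k<-N$. A point $z\in X$ is generic for a Borel probability measure $\mu$ on $X$ if $\lim_{N\to\infty}\frac1N\sum_{k=0}^{N-1}f(\sigma^k(z))=\int f\,d\mu$ for all continuous $f:X\to\mathbb R$. A measure $\mu$ is a generic measure on $X$ if some $z\in X$ is generic for $\mu$. *)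

theory Defs
  imports "HOL-Probability.Probability"
begin

text \<open>
  The alphabet is a type \<open>'a\<close> of the classes \<open>finite\<close> and \<open>discrete_topology\<close>, so that the
  library topology on \<open>int \<Rightarrow> 'a\<close> is the product topology of discrete finite spaces.
\<close>

definition shift :: "(int \<Rightarrow> 'a) \<Rightarrow> (int \<Rightarrow> 'a)" where
  "shift x = (\<lambda>k. x (k + 1))"

text \<open>Integer powers of the shift; the two lemmas below justify the closed form.\<close>

definition shift_power :: "int \<Rightarrow> (int \<Rightarrow> 'a) \<Rightarrow> (int \<Rightarrow> 'a)" where
  "shift_power n x = (\<lambda>k. x (k + n))"

lemma shift_power_of_nat: "shift_power (int n) = shift ^^ n"
proof (induction n)
  case 0
  show ?case by (auto simp: shift_power_def fun_eq_iff)
next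
  case (Suc n)
  have "shift_power (int (Suc n)) x = (shift ^^ Suc n) x" for x :: "int \<Rightarrow> 'a"
    by (simp add: Suc.IH[symmetric] shift_def shift_power_def algebra_simps)
  then show ?case by (simp add: fun_eq_iff)
qed

lemma shift_power_neg:
  "shift_power (- n) (shift_power n x) = x" "shift_power n (shift_power (- n) x) = x"
  by (simp_all add: shift_power_def)

definition orbit :: "(int \<Rightarrow> 'a) \<Rightarrow> (int \<Rightarrow> 'a) set" where
  "orbit x = {shift_power n x | n. True}"

definition subshift :: "(int \<Rightarrow> 'a :: {finite, discrete_topology}) set \<Rightarrow> bool" where
  "subshift X \<longleftrightarrow> closed X \<and> shift ` X = X"

definition words :: "(int \<Rightarrow> 'a) set \<Rightarrow> nat \<Rightarrow> 'a list set" where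
  "words X n = {map (\<lambda>i. x (k + int i)) [0..<n] | x k. x \<in> X}"

definition complexity :: "(int \<Rightarrow> 'a) set \<Rightarrow> nat \<Rightarrow> nat" where
  "complexity X n = card (words X n)"

definition eventually_periodic_right :: "(int \<Rightarrow> 'a) \<Rightarrow> bool" where
  "eventually_periodic_right x \<longleftrightarrow> (\<exists>p>0. \<exists>N>0. \<forall>k>N. x k = x (k + p))"

definition eventually_periodic_left :: "(int \<Rightarrow> 'a) \<Rightarrow> bool" where
  "eventually_periodic_left x \<longleftrightarrow> (\<exists>p>0. \<exists>N>0. \<forall>k. k < - N \<longrightarrow> x k = x (k - p))"

definition borel_prob_on :: "(int \<Rightarrow> 'a :: topological_space) set \<Rightarrow> (int \<Rightarrow> 'a) measure \<Rightarrow> bool" where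
  "borel_prob_on X \<mu> \<longleftrightarrow> sets \<mu> = sets (restrict_space borel X) \<and> prob_space \<mu>"

definition generic_for ::
  "(int \<Rightarrow> 'a :: topological_space) set \<Rightarrow> (int \<Rightarrow> 'a) \<Rightarrow> (int \<Rightarrow> 'a) measure \<Rightarrow> bool" where
  "generic_for X z \<mu> \<longleftrightarrow>
     (\<forall>f :: (int \<Rightarrow> 'a) \<Rightarrow> real. continuous_on X f \<longrightarrow>
        (\<lambda>N. 1 / real N * (\<Sum>k<N. f ((shift ^^ k) z))) \<longlonglongrightarrow> (\<integral>y. f y \<partial>\<mu>))"

text \<open>
  The carrier and the \<open>\<sigma>\<close>-algebra of a generic measure are determined by \<open>X\<close>, so equality of two
  of them as values of type \<open>measure\<close> is equality on all Borel subsets of \<open>X\<close>.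
\<close>

definition generic_measures ::
  "(int \<Rightarrow> 'a :: topological_space) set \<Rightarrow> (int \<Rightarrow> 'a) measure set" where
  "generic_measures X = {\<mu>. borel_prob_on X \<mu> \<and> (\<exists>z\<in>X. generic_for X z \<mu>)}"

end

theory Submission
  imports Defs
begin

text \<open>
  If \<open>x\<close> is not eventually periodic to the right, then every point of \<open>X\<close> shows a right special
  word of length \<open>n\<close> at one of the positions \<open>0, \<dots>, c\<^sub>X(n)\<close>: otherwise two of these words coincide,
  and they bound a cycle of the Rauzy graph without exit, in which \<open>x\<close> would be trapped. If \<open>x\<close> is
  not eventually periodic to the left, the same holds for left special words.
  There are at most \<open>c\<^sub>X(n+1) - c\<^sub>X(n)\<close> special words of length \<open>n\<close>, and the growth hypothesis
  makes this difference smaller than \<open>g\<close> for infinitely many \<open>n\<close> with \<open>c\<^sub>X(n) \<le> 2 g n\<close>. If there were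
  \<open>g\<close> generic measures, then generic points of two of them would share, for infinitely many \<open>n\<close>, a
  word of length \<open>n\<close> at positions \<open>O(n)\<close>. Such a window is long compared to its distance from the
  origin, so it has the frequencies of both measures, which therefore agree on cylinders.
\<close>

section \<open>Words and special words\<close>

definition factor :: "(int \<Rightarrow> 'a) \<Rightarrow> int \<Rightarrow> nat \<Rightarrow> 'a list" where
  "factor y k n = map (\<lambda>i. y (k + int i)) [0..<n]"

lemma length_factor [simp]: "length (factor y k n) = n"
  by (simp add: factor_def)

lemma factor_eq_iff: "factor y k n = factor z l n \<longleftrightarrow> (\<forall>i<n. y (k + int i) = z (l + int i))"
  by (auto simp: factor_def)

lemma factor_Suc: "factor y k (Suc n) = factor y k n @ [y (k + int n)]"
  by (simp add: factor_def)

lemma factor_Suc_left: "factor y k (Suc n) = y k # factor y (k + 1) n"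
  unfolding factor_def by (subst upt_conv_Cons, simp)
    (simp add: map_Suc_upt[symmetric] algebra_simps del: upt_Suc)

lemma words_eq: "words X n = {factor y k n | y k. y \<in> X}"
  by (simp add: words_def factor_def)

lemma factor_in_words: "y \<in> X \<Longrightarrow> factor y k n \<in> words X n"
  by (auto simp: words_eq)

lemma finite_words: "finite (words (X :: (int \<Rightarrow> 'a :: finite) set) n)"
  by (rule finite_subset[OF _ finite_lists_length_eq[of "UNIV :: 'a set" n]]) (auto simp: words_eq)

text \<open>Choose one preimage of each point of \<open>B\<close> and a second, different one of
  each point of \<open>S\<close>: all these choices are distinct. In the applications
  \<open>f\<close> deletes an end letter from words of length \<open>n + 1\<close>.\<close>

lemma card_add_branching_le:
  assumes "finite A" and "f ` A = B" and "S \<subseteq> B"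
    and branch: "\<And>b. b \<in> S \<Longrightarrow> \<exists>u\<in>A. \<exists>v\<in>A. u \<noteq> v \<and> f u = b \<and> f v = b"
  shows "card S + card B \<le> card A"
proof -
  have "\<forall>b\<in>B. \<exists>u\<in>A. f u = b"
    using assms(2) by auto
  then obtain h where h: "\<And>b. b \<in> B \<Longrightarrow> h b \<in> A" "\<And>b. b \<in> B \<Longrightarrow> f (h b) = b"
    by metis
  have "\<forall>b\<in>S. \<exists>u\<in>A. f u = b \<and> u \<noteq> h b"
    using branch by metis
  then obtain h' where h': "\<And>b. b \<in> S \<Longrightarrow> h' b \<in> A" "\<And>b. b \<in> S \<Longrightarrow> f (h' b) = b"
      "\<And>b. b \<in> S \<Longrightarrow> h' b \<noteq> h b"
    by metis
  have fin: "finite B" "finite S"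
    using assms(1-3) by (auto intro: finite_subset)
  have "card S = card (h' ` S)"
    by (metis card_image h'(2) inj_on_inverseI)
  moreover have "card B = card (h ` B)"
    by (metis card_image h(2) inj_on_inverseI)
  moreover have "h' ` S \<inter> h ` B = {}"
  proof -
    have False if "b \<in> S" "c \<in> B" "h' b = h c" for b c
      using that h(2)[of c] h'(2,3)[of b] by auto
    then show ?thesis
      by auto
  qed
  ultimately have "card S + card B = card (h' ` S \<union> h ` B)"
    using fin by (simp add: card_Un_disjoint)
  also have "\<dots> \<le> card A"
    using h(1) h'(1) assms(1) by (intro card_mono) auto
  finally show ?thesis .
qed

section \<open>Special words and the increment of the complexity\<close>

definition right_special :: "(int \<Rightarrow> 'a) set \<Rightarrow> nat \<Rightarrow> 'a list set" where
  "right_special X n =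
     {w \<in> words X n. \<exists>a b. a \<noteq> b \<and> w @ [a] \<in> words X (Suc n) \<and> w @ [b] \<in> words X (Suc n)}"

definition left_special :: "(int \<Rightarrow> 'a) set \<Rightarrow> nat \<Rightarrow> 'a list set" where
  "left_special X n =
     {w \<in> words X n. \<exists>a b. a \<noteq> b \<and> a # w \<in> words X (Suc n) \<and> b # w \<in> words X (Suc n)}"

text \<open>Deleting the last letter maps onto the words of length \<open>n\<close>, and a right
  special word has at least two preimages.\<close>

lemma card_right_special:
  fixes X :: "(int \<Rightarrow> 'a :: finite) set"
  shows "card (right_special X n) + complexity X n \<le> complexity X (Suc n)"
  unfolding complexity_def
proof (rule card_add_branching_le[where f = butlast])
  show "butlast ` words X (Suc n) = words X n"
  proof
    show "words X n \<subseteq> butlast ` words X (Suc n)"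
    proof
      fix w assume "w \<in> words X n"
      then obtain y k where "y \<in> X" "w = factor y k n"
        by (auto simp: words_eq)
      then have "w = butlast (factor y k (Suc n))"
        by (simp add: factor_Suc)
      then show "w \<in> butlast ` words X (Suc n)"
        using \<open>y \<in> X\<close> factor_in_words by blast
    qed
  qed (use factor_in_words in \<open>auto simp: words_eq[of X "Suc n"] factor_Suc\<close>)
next
  fix w assume "w \<in> right_special X n"
  then obtain a b where "a \<noteq> b" "w @ [a] \<in> words X (Suc n)" "w @ [b] \<in> words X (Suc n)"
    by (auto simp: right_special_def)
  then show "\<exists>u\<in>words X (Suc n). \<exists>v\<in>words X (Suc n). u \<noteq> v \<and> butlast u = w \<and> butlast v = w"
    by (intro bexI[of _ "w @ [a]"] bexI[of _ "w @ [b]"]) simp_all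
qed (auto simp: finite_words right_special_def)

text \<open>Here the first letter is deleted; this map is onto because points are two-sided, so
  every word extends to the left.\<close>

lemma card_left_special:
  fixes X :: "(int \<Rightarrow> 'a :: finite) set"
  shows "card (left_special X n) + complexity X n \<le> complexity X (Suc n)"
  unfolding complexity_def
proof (rule card_add_branching_le[where f = tl])
  show "tl ` words X (Suc n) = words X n"
  proof
    show "words X n \<subseteq> tl ` words X (Suc n)"
    proof
      fix w assume "w \<in> words X n"
      then obtain y k where "y \<in> X" "w = factor y k n"
        by (auto simp: words_eq)
      then have "w = tl (factor y (k - 1) (Suc n))"
        by (simp add: factor_Suc_left)
      then show "w \<in> tl ` words X (Suc n)"
        using \<open>y \<in> X\<close> factor_in_words by blast
    qed
  qed (use factor_in_words in \<open>auto simp: words_eq[of X "Suc n"] factor_Suc_left\<close>)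
next
  fix w assume "w \<in> left_special X n"
  then obtain a b where "a \<noteq> b" "a # w \<in> words X (Suc n)" "b # w \<in> words X (Suc n)"
    by (auto simp: left_special_def)
  then show "\<exists>u\<in>words X (Suc n). \<exists>v\<in>words X (Suc n). u \<noteq> v \<and> tl u = w \<and> tl v = w"
    by (intro bexI[of _ "a # w"] bexI[of _ "b # w"]) simp_all
qed (auto simp: finite_words left_special_def)

text \<open>Outside the right special words the next letter is forced, so equal windows stay equal
  when both move one place to the right.\<close>

lemma next_letter_eq:
  assumes "y \<in> X" "z \<in> X" "factor z k n \<notin> right_special X n" "factor y t n = factor z k n"
  shows "factor y (t + 1) n = factor z (k + 1) n"
proof -
  have "factor z k n @ [y (t + int n)] \<in> words X (Suc n)"
    using factor_in_words[OF assms(1), of t "Suc n"] assms(4) by (simp add: factor_Suc)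
  moreover have "factor z k n @ [z (k + int n)] \<in> words X (Suc n)"
    using factor_in_words[OF assms(2), of k "Suc n"] by (simp add: factor_Suc)
  ultimately have "y (t + int n) = z (k + int n)"
    using assms(2,3) factor_in_words[of z X k n] by (auto simp: right_special_def)
  then have "factor y t (Suc n) = factor z k (Suc n)"
    using assms(4) by (simp add: factor_Suc)
  then show ?thesis
    by (simp add: factor_Suc_left)
qed

lemma previous_letter_eq:
  assumes "y \<in> X" "z \<in> X" "factor z k n \<notin> left_special X n" "factor y t n = factor z k n"
  shows "factor y (t - 1) n = factor z (k - 1) n"
proof -
  have "y (t - 1) # factor z k n \<in> words X (Suc n)"
    using factor_in_words[OF assms(1), of "t - 1" "Suc n"] assms(4) by (simp add: factor_Suc_left)
  moreover have "z (k - 1) # factor z k n \<in> words X (Suc n)"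
    using factor_in_words[OF assms(2), of "k - 1" "Suc n"] by (simp add: factor_Suc_left)
  ultimately have "y (t - 1) = z (k - 1)"
    using assms(2,3) factor_in_words[of z X k n] by (auto simp: left_special_def)
  then have "factor y (t - 1) (Suc n) = factor z (k - 1) (Suc n)"
    using assms(4) by (simp add: factor_Suc_left)
  then show ?thesis
    by (simp add: factor_Suc)
qed

section \<open>Early occurrence of special words\<close>

lemma trapped_in_cycle:
  fixes F :: "nat \<Rightarrow> 'b" and G :: "nat \<Rightarrow> 'b"
  assumes "0 < p" and "F 0 = G 0" and "G p = G 0"
    and step: "\<And>m c. c < p \<Longrightarrow> F m = G c \<Longrightarrow> F (Suc m) = G (Suc c)"
  shows "F (m + p) = F m"
proof -
  \<comment> \<open>\<open>F\<close> runs round the closed cycle \<open>G 0\<close>, ...,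
    \<open>G (p - 1)\<close> and never leaves it.\<close>
  have "F m = G (m mod p)" for m
  proof (induction m)
    case (Suc m)
    have "F (Suc m) = G (Suc (m mod p))"
      using Suc step assms(1) by simp
    then show ?case
      using assms(3) by (simp add: mod_Suc)
  qed (simp add: assms(2))
  then show ?thesis
    by simp
qed

text \<open>The \<open>complexity X n + 1\<close> positions from 0 on carry at most
  \<open>complexity X n\<close> different words.\<close>

lemma repeated_factor:
  fixes X :: "(int \<Rightarrow> 'a :: finite) set"
  assumes "z \<in> X"
  obtains a b where "a < b" "b \<le> complexity X n" "factor z (int a) n = factor z (int b) n"
proof -
  have "(\<lambda>a. factor z (int a) n) ` {..complexity X n} \<subseteq> words X n"
    using assms factor_in_words by blast
  then have "card ((\<lambda>a. factor z (int a) n) ` {..complexity X n}) \<le> complexity X n"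
    unfolding complexity_def by (intro card_mono finite_words)
  then have "\<not> inj_on (\<lambda>a. factor z (int a) n) {..complexity X n}"
    by (intro pigeonhole) simp
  then obtain a b where "a \<noteq> b" "a \<le> complexity X n" "b \<le> complexity X n"
      "factor z (int a) n = factor z (int b) n"
    by (auto simp: inj_on_def)
  then show thesis
    using that by (metis linorder_neqE_nat)
qed

lemma right_special_occurs:
  fixes X :: "(int \<Rightarrow> 'a :: finite) set"
  assumes "x \<in> X" and "\<not> eventually_periodic_right x" and "0 < n"
    and from_x: "\<And>w. w \<in> words X n \<Longrightarrow> \<exists>t. w = factor x t n"
    and "z \<in> X"
  shows "\<exists>k\<le>complexity X n. factor z (int k) n \<in> right_special X n"
proof (rule ccontr)
  assume none: "\<not> ?thesis"
  obtain a b where ab: "a < b" "b \<le> complexity X n" "factor z (int a) n = factor z (int b) n"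
    using repeated_factor[OF \<open>z \<in> X\<close>] .
  obtain t where t: "factor x t n = factor z (int a) n"
    using from_x[OF factor_in_words[OF \<open>z \<in> X\<close>]] by metis
  \<comment> \<open>The windows of \<open>z\<close> from \<open>a\<close> to \<open>b\<close> form
    the cycle; the windows of \<open>x\<close> from \<open>t\<close> on are caught in it.\<close>
  have period: "factor x (t + int (m + (b - a))) n = factor x (t + int m) n" for m
  proof (rule trapped_in_cycle[where F = "\<lambda>m. factor x (t + int m) n"
        and G = "\<lambda>c. factor z (int a + int c) n"])
    fix m c assume "c < b - a" "factor x (t + int m) n = factor z (int a + int c) n"
    moreover have "factor z (int a + int c) n \<notin> right_special X n"
      using none ab \<open>c < b - a\<close> by (metis less_diff_conv add.commute of_nat_add order.trans less_imp_le)
    ultimately show "factor x (t + int (Suc m)) n = factor z (int a + int (Suc c)) n"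
      using next_letter_eq[OF \<open>x \<in> X\<close> \<open>z \<in> X\<close>, of "int a + int c" n "t + int m"]
      by (simp add: ac_simps)
  qed (use ab t in auto)
  have "x k = x (k + int (b - a))" if "t \<le> k" for k
  proof -
    have "factor x k n = factor x (k + int (b - a)) n"
      using period[of "nat (k - t)"] that by (simp add: algebra_simps)
    \<comment> \<open>As \<open>0 < n\<close>, equal windows have equal first letters.\<close>
    then show ?thesis
      using \<open>0 < n\<close> unfolding factor_eq_iff by (metis add_0_right of_nat_0)
  qed
  \<comment> \<open>The maximum with 1 provides the positive threshold that the definition
    demands.\<close>
  then have "\<forall>k>max 1 t. x k = x (k + int (b - a))"
    by (meson less_imp_le max.boundedE)
  moreover have "0 < int (b - a)" "0 < max 1 t"
    using ab by auto
  ultimately have "eventually_periodic_right x"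
    unfolding eventually_periodic_right_def by blast
  then show False
    using assms(2) by blast
qed

text \<open>Mirror image of the right-sided argument: the cycle is run backwards, so
  \<open>x\<close> is matched with \<open>z\<close> at the right end \<open>b\<close>.\<close>

lemma left_special_occurs:
  fixes X :: "(int \<Rightarrow> 'a :: finite) set"
  assumes "x \<in> X" and "\<not> eventually_periodic_left x" and "0 < n"
    and from_x: "\<And>w. w \<in> words X n \<Longrightarrow> \<exists>t. w = factor x t n"
    and "z \<in> X"
  shows "\<exists>k\<le>complexity X n. factor z (int k) n \<in> left_special X n"
proof (rule ccontr)
  assume none: "\<not> ?thesis"
  obtain a b where ab: "a < b" "b \<le> complexity X n" "factor z (int a) n = factor z (int b) n"
    using repeated_factor[OF \<open>z \<in> X\<close>] .
  obtain t where t: "factor x t n = factor z (int b) n"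
    using from_x[OF factor_in_words[OF \<open>z \<in> X\<close>]] by metis
  have period: "factor x (t - int (m + (b - a))) n = factor x (t - int m) n" for m
  proof (rule trapped_in_cycle[where F = "\<lambda>m. factor x (t - int m) n"
        and G = "\<lambda>c. factor z (int b - int c) n"])
    fix m c assume "c < b - a" "factor x (t - int m) n = factor z (int b - int c) n"
    moreover have "factor z (int (b - c)) n \<notin> left_special X n"
      using none ab by (metis diff_le_self order.trans)
    \<comment> \<open>The position \<open>b - c\<close> stays above \<open>a\<close>, so the
      subtraction of naturals does not truncate.\<close>
    moreover have "int (b - c) = int b - int c"
      using \<open>c < b - a\<close> by simp
    ultimately show "factor x (t - int (Suc m)) n = factor z (int b - int (Suc c)) n"
      using previous_letter_eq[OF \<open>x \<in> X\<close> \<open>z \<in> X\<close>, of "int b - int c" n "t - int m"]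
      by (simp add: algebra_simps)
  qed (use ab t in auto)
  have "x k = x (k - int (b - a))" if "k \<le> t" for k
  proof -
    have "factor x k n = factor x (k - int (b - a)) n"
      using period[of "nat (t - k)"] that by (simp add: algebra_simps)
    then show ?thesis
      using \<open>0 < n\<close> unfolding factor_eq_iff by (metis add_0_right of_nat_0)
  qed
  moreover have "k \<le> t" if "k < - max 1 (- t)" for k
    using that by linarith
  ultimately have "\<forall>k. k < - max 1 (- t) \<longrightarrow> x k = x (k - int (b - a))"
    by blast
  moreover have "0 < int (b - a)" "0 < max 1 (- t)"
    using ab by auto
  ultimately have "eventually_periodic_left x"
    unfolding eventually_periodic_left_def by blast
  then show False
    using assms(2) by blast
qed

section \<open>Cylinders\<close>

text \<open>The pattern is a whole point, of which only the values on \<open>I\<close> count. Two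
  cylinders with a common point \<open>y\<close> then meet in the cylinder of \<open>y\<close> over
  the union of their index sets.\<close>

definition cylinder :: "int set \<Rightarrow> (int \<Rightarrow> 'a) \<Rightarrow> (int \<Rightarrow> 'a) set" where
  "cylinder I v = {y. \<forall>i\<in>I. y i = v i}"

lemma open_cylinder:
  fixes v :: "int \<Rightarrow> 'a :: discrete_topology"
  assumes "finite I"
  shows "open (cylinder I v)"
proof -
  have "cylinder I v = (\<Inter>i\<in>I. (\<lambda>y. y i) -` {v i})"
    by (auto simp: cylinder_def)
  then show ?thesis
    using assms by (auto intro!: open_INT open_vimage Topological_Spaces.open_discrete)
qed

text \<open>The indicator is a finite product of functions of one coordinate in a discrete space.
  This makes it a test function for \<open>generic_for\<close>.\<close>

lemma continuous_on_indicator_cylinder: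
  fixes v :: "int \<Rightarrow> 'a :: discrete_topology"
  assumes "finite I"
  shows "continuous_on X (indicat_real (cylinder I v))"
proof -
  have "indicat_real (cylinder I v) = (\<lambda>y. \<Prod>i\<in>I. indicat_real {v i} (y i))"
    using assms by (auto simp: fun_eq_iff cylinder_def indicator_def prod_zero_iff)
  moreover have "continuous_on X (\<lambda>y. indicat_real {v i} (y i))" for i
    by (rule continuous_on_compose2[where t = UNIV])
      (auto intro: continuous_on_subset[OF continuous_on_product_coordinates])
  ultimately show ?thesis
    by (simp add: continuous_on_prod)
qed

lemma cylinder_in_open:
  fixes U :: "(int \<Rightarrow> 'a :: discrete_topology) set"
  assumes "open U" "y \<in> U"
  obtains L where "cylinder {- int L..int L} y \<subseteq> U"
proof -
  have "openin (product_topology (\<lambda>_. euclidean) UNIV) U"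
    using assms(1) by (simp add: euclidean_product_topology)
  from product_topology_open_contains_basis[OF this assms(2)]
  obtain B where B: "y \<in> Pi\<^sub>E UNIV B" "finite {i. B i \<noteq> UNIV}" "Pi\<^sub>E UNIV B \<subseteq> U"
    by auto
  obtain L where L: "\<And>i. B i \<noteq> UNIV \<Longrightarrow> nat \<bar>i\<bar> \<le> L"
    using finite_imageI[OF B(2), of "\<lambda>i. nat \<bar>i\<bar>"] by (auto simp: finite_nat_set_iff_bounded_le)
  have "cylinder {- int L..int L} y \<subseteq> Pi\<^sub>E UNIV B"
  proof
    fix u assume u: "u \<in> cylinder {- int L..int L} y"
    have "u i \<in> B i" for i
    proof (cases "B i = UNIV")
      case False
      then have "i \<in> {- int L..int L}"
        using L[of i] by auto
      then show ?thesis
        using u B(1) by (auto simp: cylinder_def PiE_iff)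
    qed simp
    then show "u \<in> Pi\<^sub>E UNIV B"
      by (simp add: PiE_iff)
  qed
  from that[OF order.trans[OF this B(3)]] show thesis .
qed

section \<open>Cylinders determine Borel probability measures\<close>

lemma finite_cylinders:
  assumes "finite I"
  shows "finite (range (cylinder I :: _ \<Rightarrow> (int \<Rightarrow> 'a :: finite) set))"
proof -
  have "cylinder I v = cylinder I (restrict v I)" for v :: "int \<Rightarrow> 'a"
    by (auto simp: cylinder_def)
  then have "range (cylinder I :: _ \<Rightarrow> (int \<Rightarrow> 'a) set) \<subseteq> cylinder I ` (I \<rightarrow>\<^sub>E UNIV)"
    by (metis (no_types, lifting) UNIV_I image_eqI image_subsetI restrict_PiE_iff)
  then show ?thesis
    by (rule finite_subset) (simp add: assms finite_PiE)
qed

lemma sets_borel_eq_cylinders: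
  "sets (borel :: (int \<Rightarrow> 'a :: {finite, discrete_topology}) measure) =
     sigma_sets UNIV {cylinder I v | I v. finite I}" (is "_ = sigma_sets UNIV ?G")
proof
  have "U \<in> sigma_sets UNIV ?G" if "open U" for U :: "(int \<Rightarrow> 'a) set"
  proof -
    \<comment> \<open>An open set is the union of the cylinders over symmetric intervals inside it.
      For each \<open>L\<close> there are finitely many of them, so the union is countable.\<close>
    define \<F> where "\<F> L = {C \<in> range (cylinder {- int L..int L}). C \<subseteq> U}" for L
    have "finite (\<F> L)" for L
      unfolding \<F>_def by (intro finite_Collect_conjI disjI1) (simp add: finite_cylinders)
    then have "countable (\<Union>L. \<F> L)"
      by (auto intro: countable_finite)
    moreover have "(\<Union>L. \<F> L) \<subseteq> ?G"
      by (auto simp: \<F>_def)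
    moreover have "\<Union>(\<Union>L. \<F> L) = U"
    proof
      show "U \<subseteq> \<Union>(\<Union>L. \<F> L)"
      proof
        fix y assume "y \<in> U"
        then obtain L where "cylinder {- int L..int L} y \<subseteq> U"
          using cylinder_in_open \<open>open U\<close> by blast
        moreover have "y \<in> cylinder {- int L..int L} y"
          by (simp add: cylinder_def)
        ultimately show "y \<in> \<Union>(\<Union>L. \<F> L)"
          by (auto simp: \<F>_def)
      qed
    qed (auto simp: \<F>_def)
    ultimately show ?thesis
      by (metis (no_types, lifting) sigma_sets.Basic sigma_sets_UNION subsetD)
  qed
  then show "sets borel \<subseteq> sigma_sets UNIV ?G"
    unfolding borel_def by (auto intro!: sigma_sets_mono simp: sets_measure_of)
  show "sigma_sets UNIV ?G \<subseteq> sets borel"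
    by (rule sets.sigma_sets_subset') (auto intro!: borel_open open_cylinder)
qed

lemma borel_prob_on_eqI:
  fixes X :: "(int \<Rightarrow> 'a :: {finite, discrete_topology}) set"
  assumes "closed X" and \<mu>: "borel_prob_on X \<mu>" and \<nu>: "borel_prob_on X \<nu>"
    and eq: "\<And>I v. finite I \<Longrightarrow> measure \<mu> (X \<inter> cylinder I v) = measure \<nu> (X \<inter> cylinder I v)"
  shows "\<mu> = \<nu>"
proof -
  let ?G = "{cylinder I v | I (v :: int \<Rightarrow> 'a). finite I}"
  have "X \<in> sigma_sets UNIV ?G"
    using borel_closed[OF \<open>closed X\<close>] by (simp add: sets_borel_eq_cylinders)
  then have "sets (restrict_space borel X) = sigma_sets X ((\<inter>) X ` ?G)"
    by (simp add: sets_restrict_space sets_borel_eq_cylinders sigma_sets_Int)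
  then have sets: "sets \<mu> = sigma_sets X ((\<inter>) X ` ?G)" "sets \<nu> = sigma_sets X ((\<inter>) X ` ?G)"
    using \<mu> \<nu> by (auto simp: borel_prob_on_def)
  interpret \<mu>: prob_space \<mu>
    using \<mu> by (simp add: borel_prob_on_def)
  interpret \<nu>: prob_space \<nu>
    using \<nu> by (simp add: borel_prob_on_def)
  \<comment> \<open>Disjoint cylinders have empty intersection, so the empty set is added to make
    the generator stable under intersection.\<close>
  let ?E = "insert {} ((\<inter>) X ` ?G)"
  have E: "sigma_sets X ?E = sigma_sets X ((\<inter>) X ` ?G)"
    by (rule sigma_sets_eqI) (auto intro: sigma_sets.intros)
  have X: "X \<in> (\<inter>) X ` ?G"
    by (rule image_eqI[of _ _ "cylinder {} undefined"]) (auto simp: cylinder_def)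
  show ?thesis
  proof (rule measure_eqI_generator_eq[where E = ?E and \<Omega> = X and A = "\<lambda>_. X"])
    show "Int_stable ?E"
    proof (rule Int_stableI)
      fix A B assume AB: "A \<in> ?E" "B \<in> ?E"
      show "A \<inter> B \<in> ?E"
      proof (cases "A \<inter> B = {}")
        case False
        then obtain y where y: "y \<in> A" "y \<in> B"
          by auto
        with AB obtain I v J w where A: "A = X \<inter> cylinder I v" "finite I"
          and B: "B = X \<inter> cylinder J w" "finite J"
          by auto
        have "A \<inter> B = X \<inter> cylinder (I \<union> J) y"
          using y unfolding A B cylinder_def by auto
        then show ?thesis
          using A(2) B(2) by blast
      qed simp
    qed
    show "emeasure \<mu> A = emeasure \<nu> A" if "A \<in> ?E" for A
      using that eq by (auto simp: \<mu>.emeasure_eq_measure \<nu>.emeasure_eq_measure)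
  qed (use sets E X in auto)
qed

section \<open>Frequencies in windows\<close>

text \<open>A window sum is the difference of the prefix sums up to \<open>k + n\<close> and up to
  \<open>k\<close>. Since \<open>k\<close> is at most \<open>K * n\<close>, the errors of both
  prefixes are small compared to \<open>n\<close>.\<close>

lemma tendsto_average_window:
  fixes f :: "nat \<Rightarrow> real"
  assumes lim: "(\<lambda>N. 1 / real N * (\<Sum>k<N. f k)) \<longlonglongrightarrow> \<alpha>" and "0 < e"
  shows "\<forall>\<^sub>F n in sequentially. \<forall>k\<le>K * n. \<bar>(\<Sum>i<n. f (k + i)) - real n * \<alpha>\<bar> \<le> e * real n"
proof -
  define S where "S m = (\<Sum>k<m. f k) - real m * \<alpha>" for m
  \<comment> \<open>The two prefixes have total length at most \<open>(2 * K + 1) * n\<close>, so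
    their linear errors add up to at most \<open>e * n / 2\<close>.\<close>
  define d where "d = e / (2 * (2 * real K + 1))"
  have "0 < d"
    using \<open>0 < e\<close> by (simp add: d_def)
  then obtain M where M: "\<And>m. m \<ge> M \<Longrightarrow> \<bar>1 / real m * (\<Sum>k<m. f k) - \<alpha>\<bar> < d"
    using LIMSEQ_D[OF lim] by auto
  have large: "\<bar>S m\<bar> \<le> d * real m" if "m \<ge> M" for m
  proof (cases "m = 0")
    case False
    then have "S m = real m * (1 / real m * (\<Sum>k<m. f k) - \<alpha>)"
      by (simp add: S_def field_simps)
    then show ?thesis
      using M[OF that] False by (simp add: abs_mult mult.commute)
  qed (simp add: S_def)
  \<comment> \<open>\<open>B\<close> absorbs the finitely many prefixes shorter than
    \<open>M\<close>, whose averages need not be close to \<alpha>.\<close>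
  define B where "B = (\<Sum>m<M. \<bar>S m\<bar>)"
  have "0 \<le> B"
    by (simp add: B_def sum_nonneg)
  have bound: "\<bar>S m\<bar> \<le> d * real m + B" for m
  proof (cases "m < M")
    case True
    then have "\<bar>S m\<bar> \<le> B"
      unfolding B_def by (intro member_le_sum) auto
    then show ?thesis
      using \<open>0 < d\<close> by (simp add: add_increasing)
  next
    case False
    then show ?thesis
      using large[of m] \<open>0 \<le> B\<close> by simp
  qed
  have "\<forall>\<^sub>F n in sequentially. 4 * B / e \<le> real n"
    using filterlim_real_sequentially by (simp add: filterlim_at_top)
  then show ?thesis
  proof eventually_elim
    case (elim n)
    show ?case
    proof (intro allI impI)
      fix k assume k: "k \<le> K * n"
      have "(\<Sum>i<k + n. f i) = (\<Sum>i<k. f i) + (\<Sum>i<n. f (k + i))"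
        using sum.atLeastLessThan_concat[of 0 k "k + n" f] sum.shift_bounds_nat_ivl[of f 0 k n]
        by (simp add: lessThan_atLeast0 add.commute)
      then have "(\<Sum>i<n. f (k + i)) - real n * \<alpha> = S (k + n) - S k"
        by (simp add: S_def algebra_simps)
      then have "\<bar>(\<Sum>i<n. f (k + i)) - real n * \<alpha>\<bar> \<le> \<bar>S (k + n)\<bar> + \<bar>S k\<bar>"
        by simp
      also have "\<dots> \<le> d * (2 * real k + real n) + 2 * B"
        using bound[of "k + n"] bound[of k] by (simp add: algebra_simps)
      also have "\<dots> \<le> d * (2 * real (K * n) + real n) + 2 * B"
        using \<open>0 < d\<close> k by (intro add_mono mult_left_mono) (simp_all del: of_nat_mult)
      also have "d * (2 * real (K * n) + real n) = e * real n / 2"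
        by (simp add: d_def field_simps)
      also have "2 * B \<le> e * real n / 2"
        using elim \<open>0 < e\<close> by (simp add: field_simps)
      finally show "\<bar>(\<Sum>i<n. f (k + i)) - real n * \<alpha>\<bar> \<le> e * real n"
        by simp
    qed
  qed
qed

text \<open>Only the first \<open>L\<close> and the last \<open>L\<close> indices can contribute,
  each at most 1. In the application a cylinder over coordinates in \<open>[-L, L]\<close> is tested
  along a common word, which decides it away from the ends.\<close>

lemma sum_diff_bounded_ends:
  fixes f h :: "nat \<Rightarrow> real"
  assumes agree: "\<And>i. L \<le> i \<Longrightarrow> i + L < n \<Longrightarrow> f i = h i"
    and bound: "\<And>i. \<bar>f i - h i\<bar> \<le> 1"
  shows "\<bar>(\<Sum>i<n. f i) - (\<Sum>i<n. h i)\<bar> \<le> 2 * real L"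
proof -
  let ?E = "{..<L} \<union> {n - L..<n}"
  have "\<bar>(\<Sum>i<n. f i) - (\<Sum>i<n. h i)\<bar> \<le> (\<Sum>i<n. \<bar>f i - h i\<bar>)"
    by (simp add: sum_subtractf[symmetric])
  also have "\<dots> \<le> (\<Sum>i<n. if i \<in> ?E then 1 else 0)"
    using agree bound by (intro sum_mono) auto
  also have "\<dots> = real (card ({..<n} \<inter> ?E))"
    by (simp add: sum.If_cases Collect_mem_eq del: Un_iff)
  also have "card ({..<n} \<inter> ?E) \<le> card {..<L} + card {n - L..<n}"
    by (rule order.trans[OF card_mono card_Un_le]) auto
  also have "card {..<L} + card {n - L..<n} \<le> 2 * L"
    by simp
  finally show ?thesis
    by simp
qed

lemma generic_measures_eqI:
  fixes X :: "(int \<Rightarrow> 'a :: {finite, discrete_topology}) set"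
  assumes "subshift X" and "borel_prob_on X \<mu>" "borel_prob_on X \<nu>"
    and y: "y \<in> X" "generic_for X y \<mu>" and z: "z \<in> X" "generic_for X z \<nu>"
    and inf: "\<exists>\<^sub>F n in sequentially. \<exists>k\<le>K * n. \<exists>l\<le>K * n. factor y (int k) n = factor z (int l) n"
  shows "\<mu> = \<nu>"
proof (rule borel_prob_on_eqI)
  show "closed X"
    using \<open>subshift X\<close> by (simp add: subshift_def)
  fix I :: "int set" and v :: "int \<Rightarrow> 'a"
  assume "finite I"
  define f where "f = indicat_real (cylinder I v)"
  have average: "(\<lambda>N. 1 / real N * (\<Sum>k<N. f ((shift ^^ k) u))) \<longlonglongrightarrow> measure M (X \<inter> cylinder I v)"
    if "borel_prob_on X M" "generic_for X u M" for u M
  proof -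
    have "space M = X"
      using that(1) sets_eq_imp_space_eq[of M "restrict_space borel X"]
      by (simp add: borel_prob_on_def space_restrict_space)
    then have "(\<integral>y. f y \<partial>M) = measure M (X \<inter> cylinder I v)"
      by (simp add: f_def Int_commute)
    moreover have "continuous_on X f"
      unfolding f_def using \<open>finite I\<close> by (rule continuous_on_indicator_cylinder)
    ultimately show ?thesis
      using that(2) unfolding generic_for_def by metis
  qed
  obtain L where L: "\<And>i. i \<in> I \<Longrightarrow> nat \<bar>i\<bar> \<le> L"
    using finite_imageI[OF \<open>finite I\<close>, of "\<lambda>i. nat \<bar>i\<bar>"] by (auto simp: finite_nat_set_iff_bounded_le)
  define \<alpha> where "\<alpha> = measure \<mu> (X \<inter> cylinder I v)"
  define \<beta> where "\<beta> = measure \<nu> (X \<inter> cylinder I v)"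
  show "\<alpha> = \<beta>"
  proof (rule ccontr)
    assume "\<alpha> \<noteq> \<beta>"
    \<comment> \<open>Two window errors of \<open>e * n\<close> and an end effect
      \<open>2 * L < 2 * e * n\<close> stay below \<open>4 * e * n\<close>, the distance of
      \<open>n * \<alpha>\<close> and \<open>n * \<beta>\<close>.\<close>
    define e where "e = \<bar>\<alpha> - \<beta>\<bar> / 4"
    have "0 < e"
      using \<open>\<alpha> \<noteq> \<beta>\<close> by (simp add: e_def)
    have "\<forall>\<^sub>F n in sequentially. real L / e < real n"
      using filterlim_real_sequentially by (simp add: filterlim_at_top_dense)
    then have ev: "\<forall>\<^sub>F n in sequentially. real L / e < real n \<and>
        (\<forall>k\<le>K * n. \<bar>(\<Sum>i<n. f ((shift ^^ (k + i)) y)) - real n * \<alpha>\<bar> \<le> e * real n) \<and>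
        (\<forall>l\<le>K * n. \<bar>(\<Sum>i<n. f ((shift ^^ (l + i)) z)) - real n * \<beta>\<bar> \<le> e * real n)"
      unfolding \<alpha>_def \<beta>_def
      by (intro eventually_conj tendsto_average_window average assms \<open>0 < e\<close>)
    obtain n k l where n: "real L / e < real n"
      and k: "k \<le> K * n" "\<bar>(\<Sum>i<n. f ((shift ^^ (k + i)) y)) - real n * \<alpha>\<bar> \<le> e * real n"
      and l: "l \<le> K * n" "\<bar>(\<Sum>i<n. f ((shift ^^ (l + i)) z)) - real n * \<beta>\<bar> \<le> e * real n"
      and eq: "factor y (int k) n = factor z (int l) n"
      using frequently_ex[OF frequently_eventually_conj[OF inf ev]] by blast
    have "f ((shift ^^ (k + i)) y) = f ((shift ^^ (l + i)) z)" if "L \<le> i" "i + L < n" for i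
    proof -
      have "((shift ^^ (k + i)) y) j = ((shift ^^ (l + i)) z) j" if "j \<in> I" for j
      proof -
        have "nat (int i + j) < n" "0 \<le> int i + j"
          using L[OF \<open>j \<in> I\<close>] \<open>L \<le> i\<close> \<open>i + L < n\<close> by auto
        then have "y (int k + (int i + j)) = z (int l + (int i + j))"
          using eq unfolding factor_eq_iff by (metis int_nat_eq)
        then show ?thesis
          by (simp add: shift_power_of_nat[symmetric] shift_power_def algebra_simps)
      qed
      then show ?thesis
        by (simp add: f_def indicator_def cylinder_def)
    qed
    then have "\<bar>(\<Sum>i<n. f ((shift ^^ (k + i)) y)) - (\<Sum>i<n. f ((shift ^^ (l + i)) z))\<bar> \<le> 2 * real L"
      by (rule sum_diff_bounded_ends) (auto simp: f_def indicator_def)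
    then have "\<bar>real n * \<alpha> - real n * \<beta>\<bar> \<le> 2 * (e * real n) + 2 * real L"
      using k(2) l(2) by linarith
    moreover have "\<bar>real n * \<alpha> - real n * \<beta>\<bar> = 4 * (e * real n)"
      by (simp add: e_def abs_mult right_diff_distrib[symmetric])
    moreover have "real L < e * real n"
      using n \<open>0 < e\<close> by (simp add: field_simps)
    ultimately show False
      by linarith
  qed
qed (use assms in auto)

section \<open>Counting generic measures\<close>

text \<open>The sequence \<open>D n = c n - g * n\<close> is unbounded below. Where it first falls
  below a bound \<open>B\<close> after \<open>N\<close>, its last step is negative, which is the
  small increment.\<close>

lemma frequently_small_increment:
  fixes c :: "nat \<Rightarrow> nat"
  assumes "mono c" and lim: "liminf (\<lambda>n. ereal (real (c n) - real g * real n)) = -\<infinity>"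
  shows "\<exists>\<^sub>F n in sequentially. c (Suc n) < c n + g \<and> c n \<le> 2 * g * n"
  unfolding frequently_sequentially
proof
  fix N0
  \<comment> \<open>\<open>N\<close> is positive, so that \<open>Suc k \<le> 2 * k\<close> for
    \<open>k \<ge> N\<close>.\<close>
  define N where "N = Suc N0"
  define D where "D n = int (c n) - int g * int n" for n
  \<comment> \<open>\<open>D N\<close> in the minimum forces the first drop to come after
    \<open>N\<close>, so its predecessor is still at least \<open>N\<close>; 0 gives the linear
    bound on \<open>c\<close>.\<close>
  define B where "B = min (D N) 0"
  have "\<not> (\<forall>\<^sub>F n in sequentially. ereal (real_of_int B) \<le> ereal (real (c n) - real g * real n))"
    using Liminf_bounded[of "ereal (real_of_int B)" _ sequentially] lim by fastforce
  then obtain n where n: "n \<ge> N" "real (c n) - real g * real n < real_of_int B"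
    unfolding eventually_sequentially by (auto simp: not_le)
  have "real (c n) - real g * real n = real_of_int (D n)"
    by (simp add: D_def)
  with n have ex: "n \<ge> N \<and> D n < B"
    by simp
  define m where "m = (LEAST n. n \<ge> N \<and> D n < B)"
  have m: "m \<ge> N" "D m < B"
    using LeastI[of "\<lambda>n. n \<ge> N \<and> D n < B", OF ex] by (auto simp: m_def)
  then have "m \<noteq> N"
    by (auto simp: B_def)
  then obtain k where k: "m = Suc k" "k \<ge> N"
    using m(1) by (metis Suc_leI le_antisym not_less_eq_eq old.nat.exhaust le_zero_eq)
  have "B \<le> D k"
    using not_less_Least[of k "\<lambda>n. n \<ge> N \<and> D n < B"] k by (auto simp: m_def[symmetric])
  with m(2) have "D (Suc k) < D k"
    by (simp add: k)
  then have "c (Suc k) < c k + g"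
    by (simp add: D_def algebra_simps)
  moreover have "c k \<le> 2 * g * k"
  proof -
    have "int (c (Suc k)) < int g * int (Suc k)"
      using m(2) by (simp add: k D_def B_def)
    then have "c (Suc k) < g * Suc k"
      by (simp del: of_nat_Suc flip: of_nat_mult)
    moreover have "g * Suc k \<le> g * (2 * k)"
      using \<open>k \<ge> N\<close> by (intro mult_le_mono2) (simp add: N_def)
    moreover have "c k \<le> c (Suc k)"
      using \<open>mono c\<close> by (simp add: monoD)
    ultimately show ?thesis
      by (simp only: mult.assoc mult.left_commute[of 2 g k])
  qed
  ultimately show "\<exists>n\<ge>N0. c (Suc n) < c n + g \<and> c n \<le> 2 * g * n"
    using k(2) N_def by (intro exI[of _ k]) auto
qed

text \<open>Fixing the coordinates of the word gives an open neighbourhood of \<open>y\<close>,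
  which meets the orbit of \<open>x\<close>.\<close>

lemma words_closure_orbit:
  fixes x :: "int \<Rightarrow> 'a :: discrete_topology"
  assumes "w \<in> words (closure (orbit x)) n"
  shows "\<exists>t. w = factor x t n"
proof -
  obtain y k where y: "y \<in> closure (orbit x)" "w = factor y k n"
    using assms by (auto simp: words_eq)
  let ?C = "cylinder {k..<k + int n} y"
  have "open ?C" "y \<in> ?C"
    by (auto simp: open_cylinder) (simp add: cylinder_def)
  then have "?C \<inter> orbit x \<noteq> {}"
    using y(1) by (auto simp: closure_iff_nhds_not_empty)
  then obtain s where "shift_power s x \<in> ?C"
    by (auto simp: orbit_def)
  then have "x (k + int i + s) = y (k + int i)" if "i < n" for i
    using that by (simp add: cylinder_def shift_power_def)
  then have "w = factor x (k + s) n"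
    by (simp add: y(2) factor_eq_iff add.commute add.left_commute)
  then show ?thesis
    by blast
qed

text \<open>The family \<open>S\<close> stands for the right or the left special words, so that one
  counting argument covers both cases.\<close>

lemma card_less_if_special_words:
  fixes X :: "(int \<Rightarrow> 'a :: {finite, discrete_topology}) set" and S :: "nat \<Rightarrow> 'a list set"
  assumes "subshift X"
    and S: "\<And>n. S n \<subseteq> words X n" "\<And>n. card (S n) + complexity X n \<le> complexity X (Suc n)"
    and occurs: "\<And>n z. 0 < n \<Longrightarrow> z \<in> X \<Longrightarrow> \<exists>k\<le>complexity X n. factor z (int k) n \<in> S n"
    and lim: "liminf (\<lambda>n. ereal (real (complexity X n) - real g * real n)) = -\<infinity>"
  shows "finite (generic_measures X) \<and> card (generic_measures X) < g"
proof (rule ccontr)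
  assume "\<not> ?thesis"
  \<comment> \<open>Exactly \<open>g\<close> generic measures can be chosen, whether the set is
    infinite or finite with at least \<open>g\<close> elements.\<close>
  then obtain \<M> where \<M>: "\<M> \<subseteq> generic_measures X" "card \<M> = g" "finite \<M>"
    by (metis infinite_arbitrarily_large not_less obtain_subset_with_card_n)
  have "\<forall>\<mu>\<in>\<M>. \<exists>z\<in>X. generic_for X z \<mu>"
    using \<M>(1) by (auto simp: generic_measures_def)
  then obtain z where z: "\<And>\<mu>. \<mu> \<in> \<M> \<Longrightarrow> z \<mu> \<in> X" "\<And>\<mu>. \<mu> \<in> \<M> \<Longrightarrow> generic_for X (z \<mu>) \<mu>"
    by metis
  define A where "A = {n. 0 < n \<and> complexity X (Suc n) < complexity X n + g \<and> complexity X n \<le> 2 * g * n}"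
  \<comment> \<open>\<open>R n\<close> relates two different measures whose generic points share a
    word of length \<open>n\<close> at positions up to \<open>2 * g * n\<close>.\<close>
  define R where "R n = (\<lambda>(\<mu>, \<nu>). \<mu> \<noteq> \<nu> \<and>
      (\<exists>k\<le>2 * g * n. \<exists>l\<le>2 * g * n. factor (z \<mu>) (int k) n = factor (z \<nu>) (int l) n))" for n
  have "mono (complexity X)"
    using S(2) by (intro incseq_SucI) (metis add_leD2)
  from frequently_eventually_conj[OF frequently_small_increment[OF this lim] eventually_gt_at_top[of 0]]
  have "infinite A"
    unfolding A_def cofinite_eq_sequentially[symmetric] frequently_cofinite by simp
  moreover have "\<forall>n\<in>A. \<exists>\<mu>\<nu>\<in>\<M> \<times> \<M>. R n \<mu>\<nu>"
  proof
    fix n assume n: "n \<in> A"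
    have "\<forall>\<mu>\<in>\<M>. \<exists>k\<le>complexity X n. factor (z \<mu>) (int k) n \<in> S n"
      using occurs z(1) n by (auto simp: A_def)
    then obtain k where k: "\<And>\<mu>. \<mu> \<in> \<M> \<Longrightarrow> k \<mu> \<le> complexity X n"
        "\<And>\<mu>. \<mu> \<in> \<M> \<Longrightarrow> factor (z \<mu>) (int (k \<mu>)) n \<in> S n"
      by metis
    have "card (S n) < card \<M>"
      using S(2)[of n] n \<M>(2) by (auto simp: A_def)
    moreover have "finite (S n)"
      using S(1) finite_words by (rule finite_subset)
    ultimately have "\<not> inj_on (\<lambda>\<mu>. factor (z \<mu>) (int (k \<mu>)) n) \<M>"
      using k(2) by (meson card_inj_on_le image_subsetI not_le)
    then obtain \<mu> \<nu> where "\<mu> \<in> \<M>" "\<nu> \<in> \<M>" "\<mu> \<noteq> \<nu>"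
        "factor (z \<mu>) (int (k \<mu>)) n = factor (z \<nu>) (int (k \<nu>)) n"
      by (auto simp: inj_on_def)
    moreover from this have "k \<mu> \<le> 2 * g * n" "k \<nu> \<le> 2 * g * n"
      using k(1) n by (auto simp: A_def intro: order.trans)
    ultimately show "\<exists>\<mu>\<nu>\<in>\<M> \<times> \<M>. R n \<mu>\<nu>"
      by (auto simp: R_def)
  qed
  \<comment> \<open>Infinitely many lengths and finitely many pairs: a single pair collides for
    infinitely many \<open>n\<close>.\<close>
  ultimately obtain \<mu> \<nu> where \<mu>\<nu>: "\<mu> \<in> \<M>" "\<nu> \<in> \<M>" and inf: "infinite {n \<in> A. R n (\<mu>, \<nu>)}"
    using pigeonhole_infinite_rel[of A "\<M> \<times> \<M>" R] \<M>(3) by auto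
  have "\<mu> \<noteq> \<nu>"
    using not_finite_existsD[OF inf] by (auto simp: R_def)
  have "infinite {n. R n (\<mu>, \<nu>)}"
    by (rule infinite_super[OF _ inf]) auto
  then have "\<exists>\<^sub>F n in sequentially. R n (\<mu>, \<nu>)"
    by (simp add: cofinite_eq_sequentially[symmetric] frequently_cofinite)
  then have "\<exists>\<^sub>F n in sequentially. \<exists>k\<le>2 * g * n. \<exists>l\<le>2 * g * n.
      factor (z \<mu>) (int k) n = factor (z \<nu>) (int l) n"
    by (rule frequently_elim1) (auto simp: R_def)
  then have "\<mu> = \<nu>"
    using \<mu>\<nu> z \<M>(1) by (intro generic_measures_eqI[OF \<open>subshift X\<close>]) (auto simp: generic_measures_def)
  then show False
    using \<open>\<mu> \<noteq> \<nu>\<close> by blast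
qed

theorem theorem1p5:
  fixes x :: "int \<Rightarrow> 'a :: {finite, discrete_topology}"
    and X :: "(int \<Rightarrow> 'a) set"
    and g :: nat
  assumes "subshift X"
    and "X = closure (orbit x)"
    and "\<not> (eventually_periodic_right x \<and> eventually_periodic_left x)"
    and "liminf (\<lambda>n. ereal (real (complexity X n) - real g * real n)) = -\<infinity>"
  shows "finite (generic_measures X) \<and> int (card (generic_measures X)) \<le> int g - 1"
proof -
  have "x = shift_power 0 x"
    by (simp add: shift_power_def)
  then have "x \<in> orbit x"
    unfolding orbit_def by blast
  then have "x \<in> X"
    using assms(2) closure_subset by blast
  have from_x: "\<exists>t. w = factor x t n" if "w \<in> words X n" for w n
    using that words_closure_orbit by (simp add: assms(2))
  \<comment> \<open>The strict inequality of naturals gives the integer bound, where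
    \<open>int g - 1\<close> does not truncate at \<open>g = 0\<close>.\<close>
  have "finite (generic_measures X) \<and> card (generic_measures X) < g"
  proof (cases "eventually_periodic_right x")
    case False
    show ?thesis
      by (rule card_less_if_special_words[OF assms(1) _ card_right_special _ assms(4)])
        (use right_special_occurs[OF \<open>x \<in> X\<close> False _ from_x] in \<open>auto simp: right_special_def\<close>)
  next
    case True
    then have "\<not> eventually_periodic_left x"
      using assms(3) by blast
    then show ?thesis
      by (intro card_less_if_special_words[OF assms(1) _ card_left_special _ assms(4)])
        (use left_special_occurs[OF \<open>x \<in> X\<close> _ _ from_x] in \<open>auto simp: left_special_def\<close>)
  qed
  then show ?thesis
    by auto
qed

end
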